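(* For every integer $k\ge3$ and every $\varepsilon>0$, $$\lim_{j\to\infty}\frac{\#\{m\in\{1,\dots,j\}:\ \rho_k(m)>\varepsilon\}}{j}=0.$$
   Context: $c_i(G)$ is the number of $i$-vertex cliques of a graph $G$; $\binom{n}{j}=0$ if $j>n$ or $j<0$. For a positive integer $m$, its canonical representation is the unique $m=\sum_{i=0}^s\binom{n_{k-i}}{k-i}$ with $n_k>n_{k-1}>\dots>n_{k-s}\ge k-s>0$; set $\mathrm{KK}_k(m)=\sum_{i=0}^s\binom{n_{k-i}}{k+1-i}$. The second representation is the unique $m=\binom{n_k}{k}+\binom{n_{k-1}}{k-1}+\sum_{i=1}^{t}\binom{a_{k-i}}{k-i}$ with $t\ge0$, $n_k>n_{k-1}\ge k-2$, $a_{k-1}>\dots>a_{k-t}\ge k-t>0$ and $\binom{n_{k-1}}{k-2}>\sum_{i=1}^t\binom{a_{k-i}}{k-i}$; set $\mathrm{LG}_k(m)=\binom{n_k}{k+1}+\binom{n_{k-1}}{k}+\sum_{i=1}^t\binom{a_{k-i}}{k-i+1}$. Let $\mathrm{CON}_k(m)$ be the largest number of $(k+1)$-cliques a finite simple graph with exactly $m$ $k$-cliques and at least one clique on $n_k$ vertices can have ($n_k$ the leading term above). Define $\rho_k(m)=\frac{\mathrm{LG}_k(m)-\mathrm{CON}_k(m)}{\mathrm{KK}_k(m)-\mathrm{CON}_k(m)}$ if $\mathrm{CON}_k(m)\ne\mathrm{KK}_k(m)$, and $\rho_k(m)=1$ otherwise. *)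

theory Defs
  imports "HOL-Analysis.Analysis" "HOL-Library.Ramsey"
begin

definition simple_graph :: "'a set \<Rightarrow> 'a set set \<Rightarrow> bool" where
  "simple_graph V E \<longleftrightarrow> finite V \<and> E \<subseteq> nsets V 2"

definition clique_count :: "nat \<Rightarrow> 'a set \<Rightarrow> 'a set set \<Rightarrow> nat" where
  "clique_count i V E = card {S \<in> nsets V i. clique S E}"

text \<open>The list \<open>ns\<close> is \<open>[n\<^sub>k, n\<^bsub>k-1\<^esub>, \<dots>, n\<^bsub>k-s\<^esub>]\<close>, so \<open>ns ! i\<close> is \<open>n\<^bsub>k-i\<^esub>\<close>.\<close>

definition canonical_rep :: "nat \<Rightarrow> nat \<Rightarrow> nat list \<Rightarrow> bool" where
  "canonical_rep k m ns \<longleftrightarrow>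
     (\<exists>s<k. length ns = Suc s \<and> sorted_wrt (>) ns \<and> ns ! s \<ge> k - s \<and>
        m = (\<Sum>i\<le>s. (ns ! i) choose (k - i)))"

definition canonical :: "nat \<Rightarrow> nat \<Rightarrow> nat list" where
  "canonical k m = (THE ns. canonical_rep k m ns)"

definition KK :: "nat \<Rightarrow> nat \<Rightarrow> nat" where
  "KK k m = (let ns = canonical k m in \<Sum>i<length ns. (ns ! i) choose (k + 1 - i))"

text \<open>Here \<open>n\<close> is \<open>n\<^sub>k\<close>, \<open>n'\<close> is \<open>n\<^bsub>k-1\<^esub>\<close>, and \<open>as\<close> is \<open>[a\<^bsub>k-1\<^esub>, \<dots>, a\<^bsub>k-t\<^esub>]\<close>, so
  \<open>as ! (i - 1)\<close> is \<open>a\<^bsub>k-i\<^esub>\<close>. The case \<open>t = 0\<close> is \<open>as = []\<close>.\<close>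

definition second_rep :: "nat \<Rightarrow> nat \<Rightarrow> nat \<times> nat \<times> nat list \<Rightarrow> bool" where
  "second_rep k m = (\<lambda>(n, n', as).
     let t = length as in
       n > n' \<and> n' \<ge> k - 2 \<and>
       t < k \<and> sorted_wrt (>) as \<and> (t > 0 \<longrightarrow> as ! (t - 1) \<ge> k - t) \<and>
       n' choose (k - 2) > (\<Sum>i=1..t. (as ! (i - 1)) choose (k - i)) \<and>
       m = (n choose k) + (n' choose (k - 1)) + (\<Sum>i=1..t. (as ! (i - 1)) choose (k - i)))"

definition LG :: "nat \<Rightarrow> nat \<Rightarrow> nat" where
  "LG k m = (case (THE r. second_rep k m r) of (n, n', as) \<Rightarrow>
     (n choose (k + 1)) + (n' choose k) +
     (\<Sum>i=1..length as. (as ! (i - 1)) choose (k - i + 1)))"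

text \<open>Every finite graph is isomorphic to one whose vertices are natural numbers.
  The leading term \<open>n\<^sub>k\<close> is the same in both representations, see
  \<open>second_rep_leading\<close> below.\<close>

definition CON :: "nat \<Rightarrow> nat \<Rightarrow> nat" where
  "CON k m = Max {clique_count (k + 1) V E | (V :: nat set) E.
     simple_graph V E \<and> clique_count k V E = m \<and>
     clique_count (hd (canonical k m)) V E \<ge> 1}"

definition rho :: "nat \<Rightarrow> nat \<Rightarrow> real" where
  "rho k m = (if CON k m \<noteq> KK k m
     then (real (LG k m) - real (CON k m)) / (real (KK k m) - real (CON k m))
     else 1)"


subsection \<open>Both representations exist and are unique\<close>

definition casc :: "nat \<Rightarrow> nat list \<Rightarrow> bool" where
  "casc k ns \<longleftrightarrow> length ns \<le> k \<and> sorted_wrt (>) ns \<and>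
     (ns \<noteq> [] \<longrightarrow> k + 1 - length ns \<le> last ns)"

fun cval :: "nat \<Rightarrow> nat list \<Rightarrow> nat" where
  "cval k [] = 0"
| "cval k (n # ns) = (n choose k) + cval (k - 1) ns"

lemma cval_sum: "cval k ns = (\<Sum>i<length ns. (ns ! i) choose (k - i))"
  by (induction k ns rule: cval.induct) (simp_all add: sum.lessThan_Suc_shift del: sum.lessThan_Suc)

lemma casc_Nil [simp]: "casc k []"
  by (simp add: casc_def)

lemma casc_Cons:
  "casc k (n # ns) \<longleftrightarrow> k \<ge> 1 \<and> n \<ge> k \<and> casc (k - 1) ns \<and> (ns \<noteq> [] \<longrightarrow> hd ns < n)"
proof (induction ns arbitrary: k n)
  case Nil
  then show ?case by (auto simp: casc_def)
next
  case (Cons a ns)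
  have "casc k (n # a # ns) \<longleftrightarrow> k \<ge> 1 \<and> casc (k - 1) (a # ns) \<and> a < n"
    by (cases ns) (auto simp: casc_def)
  moreover have "casc (k - 1) (a # ns) \<Longrightarrow> a \<ge> k - 1"
    using Cons.IH by blast
  ultimately show ?case by auto
qed

lemma choose_mono: "m \<le> n \<Longrightarrow> (m choose k) \<le> n choose k"
  by (rule binomial_right_mono)

lemma cval_less: "casc k (n # ns) \<Longrightarrow> cval k (n # ns) < Suc n choose k"
proof (induction ns arbitrary: k n)
  case Nil
  then obtain k' where "k = Suc k'" "k' \<le> n"
    by (cases k) (auto simp: casc_Cons)
  then show ?case by (simp add: zero_less_binomial)
next
  case (Cons a ns)
  have "k \<ge> 1" and c: "casc (k - 1) (a # ns)" "a < n"
    using Cons.prems casc_Cons[of k n "a # ns"] by auto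
  then obtain k' where k: "k = Suc k'"
    by (cases k) auto
  have "cval k' (a # ns) < Suc a choose k'" using Cons.IH c k by simp
  also have "\<dots> \<le> n choose k'" using c by (intro choose_mono) simp
  finally show ?case using k by simp
qed

lemma bracket_exists:
  assumes "k \<ge> 1" "m \<ge> 1"
  shows "\<exists>n\<ge>k. (n choose k) \<le> m \<and> m < (Suc n choose k)"
  using assms(2)
proof (induction m rule: dec_induct)
  case base
  show ?case using assms(1) by (intro exI[of _ k]) simp
next
  case (step m)
  then obtain n where n: "n \<ge> k" "(n choose k) \<le> m" "m < (Suc n choose k)" by blast
  obtain k' where k: "k = Suc k'" using assms(1) by (cases k) auto
  have "(Suc n choose k) < (Suc (Suc n) choose k)"
    using n(1) k zero_less_binomial[of k' "Suc n"] by simp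
  then show ?case
    using n by (cases "Suc m < (Suc n choose k)") (auto intro: exI[of _ n] exI[of _ "Suc n"])
qed

lemma bracket_unique:
  assumes "(n choose k) \<le> m" "m < (Suc n choose k)" "(n2 choose k) \<le> m" "m < (Suc n2 choose k)"
  shows "n = n2"
proof (rule ccontr)
  assume "n \<noteq> n2"
  then consider "Suc n \<le> n2" | "Suc n2 \<le> n" by linarith
  then show False
    using choose_mono[of "Suc n" n2 k] choose_mono[of "Suc n2" n k] assms by cases auto
qed

lemma casc_exists: "k \<ge> 1 \<Longrightarrow> \<exists>ns. casc k ns \<and> cval k ns = m"
proof (induction k arbitrary: m)
  case 0
  then show ?case by simp
next
  case (Suc k)
  show ?case
  proof (cases "m = 0")
    case True
    then show ?thesis by (intro exI[of _ "[]"]) simp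
  next
    case False
    then obtain n where n: "n \<ge> Suc k" "(n choose Suc k) \<le> m" "m < (Suc n choose Suc k)"
      using bracket_exists[of "Suc k" m] by auto
    define r where "r = m - (n choose Suc k)"
    have r: "r < (n choose k)" "m = (n choose Suc k) + r" using n by (auto simp: r_def)
    show ?thesis
    proof (cases "k = 0")
      case True
      then show ?thesis using n r by (intro exI[of _ "[n]"]) (auto simp: casc_Cons)
    next
      case False
      then obtain ns where ns: "casc k ns" "cval k ns = r" using Suc.IH[of r] by auto
      have "hd ns < n" if "ns \<noteq> []"
      proof (rule ccontr)
        assume "\<not> hd ns < n"
        then have "(n choose k) \<le> (hd ns choose k)" by (intro choose_mono) simp
        also have "\<dots> \<le> cval k ns" using that by (cases ns) auto
        finally show False using ns r by simp
      qed
      then show ?thesis using n r ns by (intro exI[of _ "n # ns"]) (auto simp: casc_Cons)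
    qed
  qed
qed

lemma cval_pos: "casc k ns \<Longrightarrow> ns \<noteq> [] \<Longrightarrow> cval k ns > 0"
  by (cases ns) (auto simp: casc_Cons zero_less_binomial)

lemma casc_unique: "casc k ns \<Longrightarrow> casc k ns2 \<Longrightarrow> cval k ns = cval k ns2 \<Longrightarrow> ns = ns2"
proof (induction ns arbitrary: k ns2)
  case Nil
  then show ?case using cval_pos[of k ns2] by force
next
  case (Cons a ns)
  then obtain b ns' where b: "ns2 = b # ns'"
    using cval_pos[of k "a # ns"] by (cases ns2) auto
  have "a = b"
    using Cons.prems b cval_less[of k a ns] cval_less[of k b ns']
    by (intro bracket_unique[of a k "cval k ns2" b]) auto
  moreover have "ns = ns'"
    using Cons.prems b calculation by (intro Cons.IH[of "k - 1"]) (auto simp: casc_Cons)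
  ultimately show ?case using b by simp
qed

lemma canonical_rep_iff: "canonical_rep k m ns \<longleftrightarrow> ns \<noteq> [] \<and> casc k ns \<and> cval k ns = m"
proof (cases ns rule: rev_cases)
  case Nil
  then show ?thesis by (auto simp: canonical_rep_def)
next
  case (snoc xs x)
  then show ?thesis
    by (auto simp: canonical_rep_def casc_def cval_sum lessThan_Suc_atMost)
qed

theorem canonical_rep_ex1:
  assumes "k \<ge> 1" "m \<ge> 1"
  shows "\<exists>!ns. canonical_rep k m ns"
proof -
  obtain ns where "casc k ns" "cval k ns = m" using casc_exists assms(1) by blast
  then have "canonical_rep k m ns" using assms(2) by (auto simp: canonical_rep_iff)
  then show ?thesis using casc_unique by (auto simp: canonical_rep_iff)
qed

lemma second_rep_iff:
  assumes "k \<ge> 3"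
  shows "second_rep k m (n, n', as) \<longleftrightarrow>
    n' < n \<and> k - 2 \<le> n' \<and> casc (k - 1) as \<and> cval (k - 1) as < (n' choose (k - 2)) \<and>
    m = (n choose k) + (n' choose (k - 1)) + cval (k - 1) as"
proof -
  have "(\<Sum>i=1..length as. (as ! (i - 1)) choose (k - i)) = cval (k - 1) as"
    by (simp add: cval_sum sum.atLeast1_atMost_eq)
  moreover have "casc (k - 1) as \<longleftrightarrow> length as < k \<and> sorted_wrt (>) as \<and>
     (length as > 0 \<longrightarrow> as ! (length as - 1) \<ge> k - length as)"
    using assms by (auto simp: casc_def last_conv_nth)
  ultimately show ?thesis by (auto simp: second_rep_def Let_def)
qed

lemma second_rep_brackets:
  assumes "k \<ge> 3" "second_rep k m (n, n', as)"
  shows "(n choose k) \<le> m" "m < (Suc n choose k)"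
    "(n' choose (k - 1)) \<le> m - (n choose k)" "m - (n choose k) < (Suc n' choose (k - 1))"
proof -
  define j where "j = k - 2"
  have k: "k = Suc (Suc j)" using assms(1) by (simp add: j_def)
  note r = assms(2)[unfolded second_rep_iff[OF assms(1)]]
  show "(n choose k) \<le> m" "(n' choose (k - 1)) \<le> m - (n choose k)" using r by auto
  show *: "m - (n choose k) < (Suc n' choose (k - 1))" using r k by simp
  have "(Suc n' choose (k - 1)) \<le> (n choose (k - 1))" using r by (intro choose_mono) simp
  then show "m < (Suc n choose k)" using * k by simp
qed

theorem second_rep_ex1:
  assumes "k \<ge> 3" "m \<ge> 1"
  shows "\<exists>!r. second_rep k m r"
proof -
  define j where "j = k - 2"
  have k: "k = Suc (Suc j)" using assms(1) by (simp add: j_def)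
  obtain n where n: "n \<ge> k" "(n choose k) \<le> m" "m < (Suc n choose k)"
    using bracket_exists[of k m] assms by auto
  define r where "r = m - (n choose k)"
  have r: "m = (n choose k) + r" "r < (n choose Suc j)" using n k by (auto simp: r_def)
  obtain n' where n': "j \<le> n'" "(n' choose Suc j) \<le> r" "r < (Suc n' choose Suc j)"
  proof (cases "r = 0")
    case True
    then show ?thesis using that[of j] by simp
  next
    case False
    then obtain n' where "n' \<ge> Suc j" "(n' choose Suc j) \<le> r" "r < (Suc n' choose Suc j)"
      using bracket_exists[of "Suc j" r] by auto
    then show ?thesis using that[of n'] by simp
  qed
  have "n' < n"
  proof (rule ccontr)
    assume "\<not> n' < n"
    then have "(n choose Suc j) \<le> (n' choose Suc j)" by (intro choose_mono) simp
    then show False using n' r by simp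
  qed
  obtain as where "casc (Suc j) as" "cval (Suc j) as = r - (n' choose Suc j)"
    using casc_exists[of "Suc j"] by auto
  then have "second_rep k m (n, n', as)"
    unfolding second_rep_iff[OF assms(1)] using \<open>n' < n\<close> n' r k by auto
  moreover have "x = y" if x: "second_rep k m x" and y: "second_rep k m y" for x y
  proof -
    obtain a b c where xe: "x = (a, b, c)" by (rule prod_cases3)
    obtain a' b' c' where ye: "y = (a', b', c')" by (rule prod_cases3)
    note X = second_rep_brackets[OF assms(1) x[unfolded xe]]
    note Y = second_rep_brackets[OF assms(1) y[unfolded ye]]
    have a: "a = a'" using bracket_unique X(1,2) Y(1,2) by blast
    have b: "b = b'" using bracket_unique X(3,4) Y(3,4) a by blast
    have "c = c'"
      using x y a b unfolding xe ye second_rep_iff[OF assms(1)]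
      by (intro casc_unique[of "k - 1"]) auto
    then show ?thesis using a b xe ye by simp
  qed
  ultimately show ?thesis by blast
qed

lemma second_rep_leading:
  assumes "k \<ge> 3" "m \<ge> 1" "second_rep k m (n, n', as)"
  shows "hd (canonical k m) = n"
proof -
  have "canonical_rep k m (canonical k m)"
    unfolding canonical_def by (rule theI'[OF canonical_rep_ex1]) (use assms in simp_all)
  then obtain a ns where c: "canonical k m = a # ns" "casc k (a # ns)" "cval k (a # ns) = m"
    by (cases "canonical k m") (auto simp: canonical_rep_iff)
  have "a = n"
    using c cval_less[OF c(2)] second_rep_brackets(1,2)[OF assms(1,3)]
    by (intro bracket_unique[of a k m n]) auto
  then show ?thesis using c by simp
qed

end

theory Submission
  imports Defs
begin

text \<open>
  Write \<open>m = C(n,k) + C(n',k-1) + q\<close> as in the second representation and let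
  \<open>base = C(n,k+1) + C(n',k)\<close>. Attaching one vertex to \<open>n'\<close> vertices of an \<open>n\<close>-clique, and then \<open>q\<close>
  vertices to \<open>k-1\<close> clique vertices each, shows \<open>CON \<ge> base\<close>. Conversely \<open>CON\<close> and \<open>LG\<close> are both at
  most \<open>base + o(n\<^bsup>k-1\<^esup>)\<close>: for \<open>LG\<close> this is a direct estimate, for \<open>CON\<close> it is a stability argument
  based on a weak form of the Kruskal--Katona theorem. Since \<open>KK - base\<close> is of order \<open>n\<^bsup>k-1\<^esup>\<close> as soon
  as \<open>q \<ge> \<delta> n\<^bsup>k-2\<^esup>\<close>, the ratio is then small; and the \<open>m\<close> with \<open>q < \<delta> n\<^bsup>k-2\<^esup>\<close> have density
  \<open>O(\<delta>)\<close>, as they are determined by the triple \<open>(n, n', q)\<close>.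
\<close>

section \<open>Clique counts through neighbourhoods, and a weak Kruskal--Katona bound\<close>

text \<open>The counting lemmas allow an arbitrary \<open>E\<close>; the condition
  \<open>u \<noteq> v\<close> keeps \<open>v\<close> out of its own neighbourhood even when
  \<open>{v} \<in> E\<close>.\<close>

definition nbrs :: "'a set set \<Rightarrow> 'a \<Rightarrow> 'a set" where
  "nbrs E v = {u. u \<noteq> v \<and> {v, u} \<in> E}"

lemma clique_insert_nbrs:
  "v \<notin> S \<Longrightarrow> clique (insert v S) E \<longleftrightarrow> clique S E \<and> S \<subseteq> nbrs E v"
  by (auto simp: clique_def nbrs_def insert_commute doubleton_eq_iff)

lemma finite_cliques: "finite U \<Longrightarrow> finite {S \<in> nsets U i. clique S E}"
  by (simp add: finite_imp_finite_nsets)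

lemma clique_count_mono: "finite W \<Longrightarrow> U \<subseteq> W \<Longrightarrow> clique_count i U E \<le> clique_count i W E"
  unfolding clique_count_def by (intro card_mono finite_cliques) (auto simp: nsets_def)

text \<open>Deleting \<open>v\<close> is a bijection onto the \<open>i\<close>-cliques in its
  neighbourhood, with inverse \<open>insert v\<close>.\<close>

lemma card_cliques_through:
  assumes "finite U" "v \<in> U"
  shows "card {S \<in> nsets U (Suc i). clique S E \<and> v \<in> S} = clique_count i (U \<inter> nbrs E v) E"
proof -
  have "bij_betw (insert v) {S \<in> nsets (U \<inter> nbrs E v) i. clique S E}
      {S \<in> nsets U (Suc i). clique S E \<and> v \<in> S}"
  proof (rule bij_betw_byWitness[where f' = "\<lambda>S. S - {v}"], goal_cases)
    case 1
    then show ?case by (auto simp: nsets_def nbrs_def)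
  next
    case 2
    then show ?case by auto
  next
    case 3
    have "insert v S \<in> nsets U (Suc i) \<and> clique (insert v S) E"
      if S: "S \<in> nsets (U \<inter> nbrs E v) i" "clique S E" for S
    proof -
      have "v \<notin> S" "S \<subseteq> U \<inter> nbrs E v" "finite S" "card S = i"
        using S by (auto simp: nsets_def nbrs_def)
      then show ?thesis using S assms by (simp add: nsets_def clique_insert_nbrs)
    qed
    then show ?case by auto
  next
    case 4
    have "S - {v} \<in> nsets (U \<inter> nbrs E v) i \<and> clique (S - {v}) E"
      if S: "S \<in> nsets U (Suc i)" "clique S E" "v \<in> S" for S
    proof -
      have "clique (insert v (S - {v})) E" using S by (simp add: insert_absorb)
      then have "clique (S - {v}) E" "S - {v} \<subseteq> nbrs E v"
        by (simp_all add: clique_insert_nbrs del: insert_Diff_single)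
      then show ?thesis using S by (auto simp: nsets_def)
    qed
    then show ?case by auto
  qed
  then show ?thesis by (simp add: clique_count_def bij_betw_same_card)
qed

text \<open>The graph form of Pascal's rule: cliques split according to whether they contain
  \<open>v\<close>.\<close>

lemma clique_count_insert:
  assumes "finite U" "v \<notin> U"
  shows "clique_count (Suc i) (insert v U) E =
    clique_count (Suc i) U E + clique_count i (U \<inter> nbrs E v) E"
proof -
  have "{S \<in> nsets (insert v U) (Suc i). clique S E} =
      {S \<in> nsets U (Suc i). clique S E} \<union> {S \<in> nsets (insert v U) (Suc i). clique S E \<and> v \<in> S}"
    by (auto simp: nsets_def)
  moreover have "{S \<in> nsets U (Suc i). clique S E} \<inter>
      {S \<in> nsets (insert v U) (Suc i). clique S E \<and> v \<in> S} = {}"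
    using assms by (auto simp: nsets_def)
  moreover have "insert v U \<inter> nbrs E v = U \<inter> nbrs E v" by (auto simp: nbrs_def)
  ultimately show ?thesis
    using assms card_cliques_through[of "insert v U" v i E]
    unfolding clique_count_def
    by (simp add: card_Un_disjoint finite_imp_finite_nsets)
qed

text \<open>Double counting of the pairs of a vertex and a clique containing it.\<close>

lemma clique_count_handshake:
  assumes "finite U"
  shows "Suc i * clique_count (Suc i) U E = (\<Sum>v\<in>U. clique_count i (U \<inter> nbrs E v) E)"
proof -
  have "(\<Sum>v\<in>U. clique_count i (U \<inter> nbrs E v) E) =
      (\<Sum>v\<in>U. card {S \<in> {S \<in> nsets U (Suc i). clique S E}. v \<in> S})"
    using assms by (intro sum.cong refl) (simp add: card_cliques_through flip: Collect_conj_eq)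
  also have "\<dots> = Suc i * card {S \<in> nsets U (Suc i). clique S E}"
  proof (rule sum_multicount[OF assms finite_cliques[OF assms]], rule ballI)
    fix S assume "S \<in> {S \<in> nsets U (Suc i). clique S E}"
    moreover from this have "{v \<in> U. v \<in> S} = S" by (auto simp: nsets_def)
    ultimately show "card {v \<in> U. v \<in> S} = Suc i" by (simp add: nsets_def)
  qed
  finally show ?thesis by (simp add: clique_count_def)
qed

lemma clique_count_0 [simp]: "clique_count 0 U E = 1"
proof -
  have "{S \<in> nsets U 0. clique S E} = {{}}" by (auto simp: nsets_def clique_def)
  then show ?thesis by (simp add: clique_count_def)
qed

lemma clique_count_clique:
  assumes "finite K" "clique K E"
  shows "clique_count i K E = card K choose i"
proof -
  have "{S \<in> nsets K i. clique S E} = nsets K i"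
    using assms by (auto simp: nsets_def clique_def)
  then show ?thesis by (simp add: clique_count_def card_nsets)
qed

text \<open>Weak Kruskal--Katona inequality, stated with an upper bound \<open>t\<close> for the \<open>i\<close>-th root of
  \<open>i! c\<^sub>i\<close>. A vertex of small degree is handled by induction in its neighbourhood; for a vertex of
  large degree the cliques in its neighbourhood are at most all the cliques.\<close>

lemma clique_count_Suc_le:
  fixes t :: real
  assumes "i \<ge> 1" "finite U" "t \<ge> 0" "fact i * real (clique_count i U E) \<le> t ^ i"
  shows "real (Suc i) * real (clique_count (Suc i) U E) \<le> t * real (clique_count i U E)"
  using assms
proof (induction i arbitrary: U t rule: dec_induct)
  case base
  have c1: "clique_count 1 W E = card W" if "finite W" for W
    using clique_count_handshake[OF that, of 0 E] by simp
  have "real (Suc 1) * real (clique_count (Suc 1) U E) = (\<Sum>v\<in>U. real (card (U \<inter> nbrs E v)))"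
    using clique_count_handshake[OF base(1), of 1 E] base(1) c1
    by (simp flip: of_nat_mult of_nat_sum)
  also have "\<dots> \<le> (\<Sum>v\<in>U. t)"
  proof (rule sum_mono)
    fix v
    have "real (card (U \<inter> nbrs E v)) \<le> real (card U)"
      using base by (simp add: card_mono)
    then show "real (card (U \<inter> nbrs E v)) \<le> t" using base c1[of U] by simp
  qed
  finally show ?case using base c1[of U] by (simp add: mult.commute)
next
  case (step i)
  let ?c = "\<lambda>i U. real (clique_count i U E)"
  let ?N = "\<lambda>v. U \<inter> nbrs E v"
  have hand: "real (Suc j) * ?c (Suc j) U = (\<Sum>v\<in>U. ?c j (?N v))" for j
    using clique_count_handshake[OF step.prems(1), of j E]
    by (simp flip: of_nat_mult of_nat_sum del: of_nat_Suc)
  have le: "real (Suc i) * ?c (Suc i) (?N v) \<le> t * ?c i (?N v)" if "v \<in> U" for v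
  proof (cases "fact i * ?c i (?N v) \<le> t ^ i")
    case True
    then show ?thesis using step.IH[of "?N v" t] step.prems by simp
  next
    case False
    have "fact i * (real (Suc i) * ?c (Suc i) (?N v)) = fact (Suc i) * ?c (Suc i) (?N v)"
      by (simp add: algebra_simps)
    also have "\<dots> \<le> fact (Suc i) * ?c (Suc i) U"
      using step.prems(1) by (intro mult_left_mono) (simp_all add: clique_count_mono)
    also have "\<dots> \<le> t * t ^ i" using step.prems(3) by simp
    also have "\<dots> \<le> t * (fact i * ?c i (?N v))"
      using False step.prems(2) by (intro mult_left_mono) simp_all
    finally have "fact i * (real (Suc i) * ?c (Suc i) (?N v)) \<le> fact i * (t * ?c i (?N v))"
      by (simp add: algebra_simps)
    then show ?thesis by (simp only: mult_le_cancel_left_pos fact_gt_zero)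
  qed
  \<comment> \<open>The handshake identity at sizes \<open>i+2\<close> and \<open>i+1\<close> turns
    the vertexwise bound \<open>le\<close> into one on \<open>U\<close>; the common factor
    \<open>Suc i\<close> cancels.\<close>
  have "real (Suc i) * (real (Suc (Suc i)) * ?c (Suc (Suc i)) U) =
      (\<Sum>v\<in>U. real (Suc i) * ?c (Suc i) (?N v))"
    unfolding hand by (simp only: sum_distrib_left)
  also have "\<dots> \<le> (\<Sum>v\<in>U. t * ?c i (?N v))" by (intro sum_mono le)
  also have "\<dots> = real (Suc i) * (t * ?c (Suc i) U)"
    by (simp only: sum_distrib_left[symmetric] hand[symmetric] mult.left_commute)
  finally show ?case by (simp only: mult_le_cancel_left_pos of_nat_0_less_iff zero_less_Suc)
qed

section \<open>Stability for graphs that contain a large clique\<close>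

text \<open>Each clique meeting \<open>A\<close> is counted at its largest vertex \<open>v\<close>
  in \<open>A\<close>; the rest of it lies in the back-neighbourhood of \<open>v\<close>, made of
  neighbours in \<open>K\<close> and earlier neighbours in \<open>A\<close>.\<close>

lemma clique_count_outside:
  fixes K :: "'a::linorder set"
  assumes "finite K" "finite A" "K \<inter> A = {}"
  shows "clique_count (Suc i) (K \<union> A) E = clique_count (Suc i) K E +
    (\<Sum>v\<in>A. clique_count i ((K \<union> {w \<in> A. w < v}) \<inter> nbrs E v) E)"
  using assms(2,3)
proof (induction A rule: finite_linorder_max_induct)
  case empty
  then show ?case by simp
next
  case (insert b A)
  have "b \<notin> A" using insert.hyps by auto
  moreover have "{w \<in> insert b A. w < b} = A" using insert.hyps by auto
  moreover have "{w \<in> insert b A. w < v} = {w \<in> A. w < v}" if "v \<in> A" for v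
    using insert.hyps that by (auto dest: less_asym)
  ultimately show ?case
    using insert assms(1) clique_count_insert[of "K \<union> A" b i E] by simp
qed

text \<open>The weak Kruskal--Katona bound holds in each back-neighbourhood with one common
  \<open>t\<close>; summing over \<open>V - K\<close> yields new cliques of two consecutive
  sizes.\<close>

lemma clique_count_outside_le:
  fixes V K :: "'a::linorder set" and t :: real
  assumes V: "finite V" "K \<subseteq> V" "clique K E" and h: "h \<ge> 1" and t: "t \<ge> 0"
    and le: "\<And>v. v \<in> V - K \<Longrightarrow>
      fact h * real (clique_count h ((K \<union> {w \<in> V - K. w < v}) \<inter> nbrs E v) E) \<le> t ^ h"
  shows "real (Suc h) * (real (clique_count (Suc (Suc h)) V E) - real (card K choose Suc (Suc h)))
    \<le> t * (real (clique_count (Suc h) V E) - real (card K choose Suc h))"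
proof -
  let ?N = "\<lambda>v. (K \<union> {w \<in> V - K. w < v}) \<inter> nbrs E v"
  have fK: "finite K" using V finite_subset by blast
  have KV: "K \<union> (V - K) = V" using V by auto
  have out: "real (clique_count (Suc i) V E) - real (card K choose Suc i) =
      (\<Sum>v\<in>V-K. real (clique_count i (?N v) E))" for i
    using clique_count_outside[of K "V - K" i E] V fK unfolding KV
    by (simp add: clique_count_clique)
  have "real (Suc h) * (\<Sum>v\<in>V-K. real (clique_count (Suc h) (?N v) E))
      = (\<Sum>v\<in>V-K. real (Suc h) * real (clique_count (Suc h) (?N v) E))"
    by (simp only: sum_distrib_left)
  also have "\<dots> \<le> (\<Sum>v\<in>V-K. t * real (clique_count h (?N v) E))"
    using V fK by (intro sum_mono clique_count_Suc_le h t le) auto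
  finally show ?thesis unfolding out by (simp only: sum_distrib_left)
qed

lemma Suc_times_choose_real:
  "real (Suc k) * real (n choose Suc k) = (real n - real k) * real (n choose k)"
proof -
  have "real (Suc n * (n choose k)) = real ((Suc n choose Suc k) * Suc k)"
    by (simp only: Suc_times_binomial_eq)
  then show ?thesis by (simp add: algebra_simps)
qed

text \<open>If there were more cliques than claimed, then by convexity a single vertex outside \<open>K\<close> would
  lie in almost all of the new \<open>h+1\<close>-cliques. Its neighbours outside \<open>K\<close> then contribute little,
  since every clique of size \<open>h+1\<close> in its neighbourhood is itself an \<open>h+1\<close>-clique avoiding it.\<close>

lemma clique_count_le_of_clique:
  fixes V K :: "'a::linorder set" and s :: real
  assumes V: "finite V" "K \<subseteq> V" "clique K E" and h: "h \<ge> 1"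
    and cnt: "clique_count (Suc h) V E = (card K choose Suc h) + r" and r: "r < Suc n' choose h"
    and s: "s = 2 * real (Suc h) * real h * real (Suc n') ^ (h - 1)"
  shows "real (clique_count (Suc (Suc h)) V E) \<le>
    real (card K choose Suc (Suc h)) + real (n' choose Suc h) + s * (1 + root h s)"
proof (rule ccontr)
  assume neg: "\<not> ?thesis"
  define N where "N = real (Suc n')"
  define T where "T = real (clique_count (Suc (Suc h)) V E) - real (card K choose Suc (Suc h))"
  define P where "P = (\<lambda>v. (K \<union> {w \<in> V - K. w < v}) \<inter> nbrs E v)"
  have fK: "finite K" using V finite_subset by blast
  have N: "N > 0" by (simp add: N_def)
  have s0: "s \<ge> 0" by (simp add: s)
  then have rs0: "root h s \<ge> 0" by (rule real_root_ge_zero)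
  then have err0: "s * (1 + root h s) \<ge> 0" using s0 by simp
  have T: "T > real (n' choose Suc h)" using neg err0 by (simp add: T_def)
  have "V - K \<noteq> {}"
  proof
    assume "V - K = {}"
    then have "V = K" using V by auto
    then have "T = 0" using V by (simp add: T_def clique_count_clique)
    then show False using T by simp
  qed
  \<comment> \<open>The vertex \<open>v\<close> attaining this maximum is the one that will turn out
    to lie in almost all new cliques.\<close>
  define R where "R = Max ((\<lambda>v. clique_count h (P v) E) ` (V - K))"
  have "R \<in> (\<lambda>v. clique_count h (P v) E) ` (V - K)"
    unfolding R_def using V \<open>V - K \<noteq> {}\<close> by (intro Max_in) auto
  then obtain v where v: "v \<in> V - K" "clique_count h (P v) E = R" by auto
  have leR: "clique_count h (P w) E \<le> R" if "w \<in> V - K" for w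
    unfolding R_def using V that by (intro Max_ge) auto
  \<comment> \<open>The smallest \<open>t\<close> for which the weak bound applies to all
    back-neighbourhoods at once.\<close>
  define y where "y = root h (fact h * real R)"
  have y0: "y \<ge> 0" by (simp add: y_def real_root_ge_zero)
  have yh: "y ^ h = fact h * real R" using h by (simp add: y_def)
  have "real (Suc h) * T \<le> y * (real (clique_count (Suc h) V E) - real (card K choose Suc h))"
    unfolding T_def
  proof (rule clique_count_outside_le[OF V h y0])
    fix w assume "w \<in> V - K"
    then show "fact h * real (clique_count h ((K \<union> {u \<in> V - K. u < w}) \<inter> nbrs E w) E) \<le> y ^ h"
      using leR[of w] unfolding yh P_def by simp
  qed
  then have Ty: "real (Suc h) * T \<le> y * real r" by (simp add: cnt)
  define B where "B = real (Suc n' choose h)"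
  have rB: "real r \<le> B" using r by (simp add: B_def)
  have B0: "B > 0" using r unfolding B_def of_nat_0_less_iff by linarith
  \<comment> \<open>The assumed excess gives \<open>T > n' choose Suc h\<close>, while
    \<open>Suc h * T \<le> y * r\<close> and \<open>r\<close> is below
    \<open>Suc n' choose h\<close>. Comparing the binomials forces
    \<open>y \<ge> N - 2 * Suc h\<close>.\<close>
  have "real (Suc h) * real (n' choose Suc h) < real (Suc h) * T"
    using T by (intro mult_strict_left_mono) auto
  then have 1: "(real n' - real h) * real (n' choose h) < y * B"
    using Ty mult_left_mono[OF rB y0] unfolding Suc_times_choose_real by linarith
  have 2: "N * real (n' choose h) = (N - real h) * B"
  proof -
    obtain g where g: "h = Suc g" using h by (cases h) auto
    have "N * real (n' choose h) - (N - real h) * B =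
       real (Suc g) * real (n' choose Suc g) - (real n' - real g) * real (n' choose g)"
      by (simp add: g N_def B_def algebra_simps)
    then show ?thesis unfolding Suc_times_choose_real by simp
  qed
  have "(real n' - real h) * (N - real h) * B = N * ((real n' - real h) * real (n' choose h))"
    by (simp only: 2[symmetric] mult.assoc mult.left_commute)
  also have "\<dots> < N * (y * B)" using 1 N by simp
  also have "\<dots> = N * y * B" by simp
  finally have "(real n' - real h) * (N - real h) * B < N * y * B" .
  then have "(real n' - real h) * (N - real h) < N * y"
    using B0 by simp
  moreover have "N * (N - 2 * real (Suc h)) \<le> (real n' - real h) * (N - real h)"
    by (simp add: N_def algebra_simps)
  ultimately have "N * (N - 2 * real (Suc h)) < N * y" by linarith
  then have y_ge: "N - 2 * real (Suc h) \<le> y" using N by simp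
  have Nh: "N ^ h = N * N ^ (h - 1)" using h by (cases h) auto
  \<comment> \<open>Here the form of \<open>s\<close> originates: it is the Bernoulli error in
    passing from \<open>N\<close> to \<open>N - 2 * Suc h\<close> in the \<open>h\<close>-th power.
    For smaller \<open>N\<close> already \<open>N ^ h \<le> s\<close>.\<close>
  have yh_ge: "N ^ h - s \<le> y ^ h"
  proof (cases "2 * real (Suc h) \<le> N")
    case True
    define x where "x = - 2 * real (Suc h) / N"
    have "-1 \<le> x" using True N by (simp add: x_def field_simps)
    have "N ^ h - s = N ^ h * (1 + real h * x)"
      unfolding s N_def[symmetric] Nh x_def using N by (simp add: field_simps)
    also have "\<dots> \<le> N ^ h * (1 + x) ^ h"
      using Bernoulli_inequality[OF \<open>-1 \<le> x\<close>, of h] N by (intro mult_left_mono) auto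
    also have "\<dots> = (N * (1 + x)) ^ h" by (simp only: power_mult_distrib)
    also have "N * (1 + x) = N - 2 * real (Suc h)" using N by (simp add: x_def field_simps)
    also have "(N - 2 * real (Suc h)) ^ h \<le> y ^ h" using True y_ge by (intro power_mono) auto
    finally show ?thesis .
  next
    case False
    then have "N * 1 \<le> 2 * real (Suc h) * real h" using h N by (intro mult_mono) auto
    then have "N * 1 * N ^ (h - 1) \<le> 2 * real (Suc h) * real h * N ^ (h - 1)"
      using N by (intro mult_right_mono) auto
    then have "N ^ h \<le> s" unfolding Nh s N_def[symmetric] by simp
    then show ?thesis using y0 by (smt (verit) zero_le_power)
  qed
  have "B * fact h \<le> N ^ h"
    using binomial_fact_pow[of "Suc n'" h] unfolding B_def N_def
    by (metis of_nat_fact of_nat_le_iff of_nat_mult of_nat_power)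
  moreover have "real r * fact h \<le> B * fact h" using rB by (intro mult_right_mono) auto
  ultimately have "real r * fact h \<le> s + fact h * real R" using yh_ge unfolding yh by linarith
  \<comment> \<open>So \<open>v\<close> lies in all but at most \<open>s / fact h\<close> of the
    \<open>r\<close> new \<open>(h+1)\<close>-cliques.\<close>
  then have rR: "fact h * (real r - real R) \<le> s" by (simp add: algebra_simps)

  define W where "W = V - {v}"
  have W: "finite W" "K \<subseteq> W" "v \<notin> W" "V = insert v W" using V v by (auto simp: W_def)
  have split: "clique_count (Suc i) V E = clique_count (Suc i) W E + clique_count i (W \<inter> nbrs E v) E" for i
    using clique_count_insert[of W v i E] W by simp
  \<comment> \<open>The number of new \<open>(h+1)\<close>-cliques avoiding \<open>v\<close>; the
    subtraction does not truncate because \<open>K \<subseteq> W\<close>.\<close>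
  define p where "p = clique_count (Suc h) W E - (card K choose Suc h)"
  have p: "clique_count (Suc h) W E = (card K choose Suc h) + p"
    using clique_count_mono[OF W(1,2), of "Suc h" E] fK V by (simp add: p_def clique_count_clique)
  have "P v \<subseteq> W \<inter> nbrs E v" using W by (auto simp: P_def nbrs_def)
  then have "R \<le> clique_count h (W \<inter> nbrs E v) E"
    using clique_count_mono[of "W \<inter> nbrs E v" "P v" h E] W v by simp
  then have pr: "p + R \<le> r" using split[of h] cnt p by simp
  have "fact h * real p \<le> fact h * (real r - real R)" using pr by (intro mult_left_mono) auto
  then have ps: "fact h * real p \<le> s" using rR by linarith
  have "real p \<le> fact h * real p"
    using fact_ge_1[of h, where 'a = real] by (simp add: mult_le_cancel_right1)
  then have ps1: "real p \<le> s" using ps by simp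

  \<comment> \<open>Once \<open>v\<close> is removed, every back-neighbourhood has at most
    \<open>p\<close> cliques of size \<open>h\<close>, and \<open>fact h * p \<le> s\<close>; the
    weak bound thus applies with the much smaller \<open>t = root h s\<close>.\<close>
  have "real (Suc h) * (real (clique_count (Suc (Suc h)) W E) - real (card K choose Suc (Suc h)))
      \<le> root h s * (real (clique_count (Suc h) W E) - real (card K choose Suc h))"
  proof (rule clique_count_outside_le[OF W(1,2) V(3) h rs0])
    fix w assume w: "w \<in> W - K"
    define A where "A = K \<union> {u \<in> W - K. u < w}"
    have A: "finite A" "w \<notin> A" "K \<subseteq> A" "insert w A \<subseteq> W"
      using w W fK by (auto simp: A_def)
    have "clique_count (Suc h) A E + clique_count h (A \<inter> nbrs E w) E \<le> clique_count (Suc h) W E"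
      using clique_count_insert[OF A(1,2), of h E] clique_count_mono[OF W(1) A(4), of "Suc h" E]
      by simp
    moreover have "(card K choose Suc h) \<le> clique_count (Suc h) A E"
      using clique_count_mono[OF A(1,3), of "Suc h" E] fK V by (simp add: clique_count_clique)
    ultimately have "clique_count h (A \<inter> nbrs E w) E \<le> p" using p by simp
    then have "fact h * real (clique_count h (A \<inter> nbrs E w) E) \<le> fact h * real p"
      by simp
    also have "\<dots> \<le> root h s ^ h" using ps s0 h by simp
    finally show "fact h * real (clique_count h ((K \<union> {u \<in> W - K. u < w}) \<inter> nbrs E w) E) \<le> root h s ^ h"
      by (simp add: A_def)
  qed
  also have "\<dots> = root h s * real p" by (simp add: p)
  also have "\<dots> \<le> root h s * s" using ps1 rs0 by (intro mult_left_mono)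
  also have "\<dots> \<le> real (Suc h) * (root h s * s)"
    using mult_nonneg_nonneg[OF rs0 s0] by (simp add: mult_le_cancel_right1)
  finally have cW: "real (clique_count (Suc (Suc h)) W E) - real (card K choose Suc (Suc h)) \<le> root h s * s"
    by (simp only: mult_le_cancel_left_pos of_nat_0_less_iff zero_less_Suc)

  \<comment> \<open>Each \<open>h\<close>-subset of \<open>D\<close> together with \<open>v\<close>
    is a new clique, so \<open>r < Suc n' choose h\<close> forces \<open>card D \<le> n'\<close>.
    This produces the main term \<open>n' choose Suc h\<close>.\<close>
  define D where "D = K \<inter> nbrs E v"
  have D: "finite D" "clique D E" using fK V by (auto simp: D_def clique_def)
  have "clique_count (Suc h) (insert v K) E \<le> clique_count (Suc h) V E"
    using V v by (intro clique_count_mono) auto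
  then have "(card D choose h) \<le> r"
    using clique_count_insert[of K v h E] fK v V D cnt by (simp add: clique_count_clique D_def)
  then have "card D \<le> n'"
    using r choose_mono[of "Suc n'" "card D" h] by (rule_tac ccontr) simp
  then have Dn: "(card D choose Suc h) \<le> n' choose Suc h" by (rule choose_mono)
  \<comment> \<open>An \<open>(h+1)\<close>-clique in the neighbourhood of \<open>v\<close> lies in
    \<open>D\<close> or is one of the \<open>p\<close> cliques of \<open>W\<close> not inside
    \<open>K\<close>; the latter cost at most \<open>s\<close>.\<close>
  have "{S \<in> nsets (W \<inter> nbrs E v) (Suc h). clique S E} \<subseteq> {S \<in> nsets D (Suc h). clique S E} \<union>
      ({S \<in> nsets W (Suc h). clique S E} - {S \<in> nsets K (Suc h). clique S E})"
    by (auto simp: nsets_def D_def)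
  then have "clique_count (Suc h) (W \<inter> nbrs E v) E \<le> card ({S \<in> nsets D (Suc h). clique S E} \<union>
      ({S \<in> nsets W (Suc h). clique S E} - {S \<in> nsets K (Suc h). clique S E}))"
    unfolding clique_count_def using D W by (intro card_mono) (auto intro: finite_cliques)
  also have "\<dots> \<le> card {S \<in> nsets D (Suc h). clique S E} +
      card ({S \<in> nsets W (Suc h). clique S E} - {S \<in> nsets K (Suc h). clique S E})"
    by (rule card_Un_le)
  also have "card ({S \<in> nsets W (Suc h). clique S E} - {S \<in> nsets K (Suc h). clique S E}) =
      clique_count (Suc h) W E - clique_count (Suc h) K E"
    unfolding clique_count_def using fK W by (intro card_Diff_subset finite_cliques) (auto simp: nsets_def)
  also have "card {S \<in> nsets D (Suc h). clique S E} = (card D choose Suc h)"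
    using clique_count_clique[OF D, of "Suc h"] by (simp add: clique_count_def)
  also have "clique_count (Suc h) W E - clique_count (Suc h) K E = p"
    using fK V by (simp add: p clique_count_clique)
  finally have "clique_count (Suc h) (W \<inter> nbrs E v) E \<le> (n' choose Suc h) + p" using Dn by simp
  then have "real (clique_count (Suc h) (W \<inter> nbrs E v) E) \<le> real (n' choose Suc h) + s"
    using ps1 by linarith
  then show False using neg cW split[of "Suc h"] by (simp add: algebra_simps)
qed

section \<open>Construction of graphs and bounds for \<open>CON\<close>\<close>

text \<open>A fresh vertex is joined to \<open>d\<close> vertices of \<open>K\<close>. These form a
  clique, so it gains \<open>d choose i\<close> cliques of size \<open>i+1\<close>; as
  \<open>K\<close> stays a clique, the step can be iterated.\<close>

lemma attach_vertex:
  fixes V :: "nat set"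
  assumes G: "simple_graph V E" and K: "K \<subseteq> V" "clique K E" and d: "d \<le> card K"
  shows "\<exists>V' E'. simple_graph V' E' \<and> K \<subseteq> V' \<and> clique K E' \<and>
    (\<forall>i. clique_count (Suc i) V' E' = clique_count (Suc i) V E + (d choose i))"
proof -
  have fV: "finite V" using G by (simp add: simple_graph_def)
  then have fK: "finite K" using K finite_subset by blast
  obtain v where v: "v \<notin> V" using fV ex_new_if_finite infinite_UNIV_nat by blast
  obtain D where D: "D \<subseteq> K" "card D = d" "finite D" using d obtain_subset_with_card_n by blast
  define E' where "E' = E \<union> (\<lambda>u. {v, u}) ` D"
  have edge: "{x, y} \<in> E' \<longleftrightarrow> {x, y} \<in> E" if "x \<in> V" "y \<in> V" for x y
    using that v by (auto simp: E'_def doubleton_eq_iff)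
  have cl: "clique S E' \<longleftrightarrow> clique S E" if "S \<subseteq> V" for S
    using that edge unfolding clique_def by blast
  have cc: "clique_count i V E' = clique_count i V E" for i
    unfolding clique_count_def by (rule arg_cong[where f = card]) (auto simp: nsets_def cl)
  have "v \<notin> e" if "e \<in> E" for e
    using that G v by (auto simp: simple_graph_def nsets_def)
  then have nb: "V \<inter> nbrs E' v = D"
    using D K v by (auto simp: nbrs_def E'_def doubleton_eq_iff)
  have clD: "clique D E'" using K D cl[of D] by (auto simp: clique_def)
  have "simple_graph (insert v V) E'"
    using G D K v fV unfolding simple_graph_def E'_def by (auto simp: nsets_def card_insert_if)
  moreover have "clique_count (Suc i) (insert v V) E' = clique_count (Suc i) V E + (d choose i)" for i
    using clique_count_insert[OF fV v, of i E'] clique_count_clique[OF D(3) clD] D by (simp add: nb cc)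
  ultimately show ?thesis using K cl[of K] by (intro exI[of _ "insert v V"] exI[of _ E']) auto
qed

lemma graph_with_clique_exists:
  assumes "n' \<le> n" "h \<le> n"
  shows "\<exists>(V::nat set) E. simple_graph V E \<and> clique_count n V E \<ge> 1 \<and>
    clique_count (Suc h) V E = (n choose Suc h) + (n' choose h) + q \<and>
    clique_count (Suc (Suc h)) V E \<ge> (n choose Suc (Suc h)) + (n' choose Suc h)"
proof -
  define K :: "nat set" where "K = {..<n}"
  have K: "finite K" "card K = n" by (simp_all add: K_def)
  have "\<exists>V E. simple_graph V E \<and> K \<subseteq> V \<and> clique K E \<and>
    clique_count (Suc h) V E = (n choose Suc h) + (n' choose h) + q \<and>
    clique_count (Suc (Suc h)) V E \<ge> (n choose Suc (Suc h)) + (n' choose Suc h)"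
  proof (induction q)
    case 0
    have "simple_graph K (nsets K 2)" "clique K (nsets K 2)"
      by (auto simp: simple_graph_def clique_def nsets_def K_def card_insert_if)
    from attach_vertex[OF this(1) subset_refl this(2), of n'] assms(1) K
    obtain V' E' where "simple_graph V' E'" "K \<subseteq> V'" "clique K E'"
      "\<And>i. clique_count (Suc i) V' E' = clique_count (Suc i) K (nsets K 2) + (n' choose i)"
      by auto
    then show ?case using K \<open>clique K (nsets K 2)\<close>
      by (intro exI[of _ V'] exI[of _ E']) (simp add: clique_count_clique)
  next
    case (Suc q)
    then obtain V E where G: "simple_graph V E" "K \<subseteq> V" "clique K E"
      "clique_count (Suc h) V E = (n choose Suc h) + (n' choose h) + q"
      "clique_count (Suc (Suc h)) V E \<ge> (n choose Suc (Suc h)) + (n' choose Suc h)" by blast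
    \<comment> \<open>Degree \<open>h\<close> adds exactly one \<open>(h+1)\<close>-clique and, as
      \<open>h choose Suc h = 0\<close>, no \<open>(h+2)\<close>-clique.\<close>
    from attach_vertex[OF G(1-3), of h] assms(2) K
    obtain V' E' where "simple_graph V' E'" "K \<subseteq> V'" "clique K E'"
      "\<And>i. clique_count (Suc i) V' E' = clique_count (Suc i) V E + (h choose i)"
      by auto
    then show ?case using G by (intro exI[of _ V'] exI[of _ E']) simp
  qed
  then obtain V E where G: "simple_graph V E" "K \<subseteq> V" "clique K E"
    "clique_count (Suc h) V E = (n choose Suc h) + (n' choose h) + q"
    "clique_count (Suc (Suc h)) V E \<ge> (n choose Suc (Suc h)) + (n' choose Suc h)" by blast
  moreover have "1 \<le> clique_count n V E"
    using clique_count_mono[of V K n E] clique_count_clique[OF K(1) G(3), of n] G K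
    by (simp add: simple_graph_def)
  ultimately show ?thesis by blast
qed

text \<open>To use the \<open>Max\<close> in \<open>CON\<close>, its set must be finite and
  nonempty: the stability bound on every member gives finiteness, the constructed graph gives a
  member and the lower bound.\<close>

lemma CON_bounds:
  fixes s :: real
  assumes k: "k \<ge> 3" and m: "m \<ge> 1" and rep: "second_rep k m (n, n', as)"
    and s: "s = 2 * real k * real (k - 1) * real (Suc n') ^ (k - 2)"
  shows "real (n choose (k + 1)) + real (n' choose k) \<le> real (CON k m)"
    and "real (CON k m) \<le> real (n choose (k + 1)) + real (n' choose k) + s * (1 + root (k - 1) s)"
proof -
  define h where "h = k - 1"
  have kh: "k = Suc h" "h \<ge> 2" using k by (auto simp: h_def)
  define q where "q = cval (k - 1) as"
  have R: "n' < n" "k - 2 \<le> n'" "q < (n' choose (k - 2))"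
    "m = (n choose k) + ((n' choose (k - 1)) + q)"
    using rep unfolding second_rep_iff[OF k] q_def by auto
  have hd: "hd (canonical k m) = n" by (rule second_rep_leading[OF k m rep])
  define A where "A = {clique_count (k + 1) V E | (V :: nat set) E.
     simple_graph V E \<and> clique_count k V E = m \<and> clique_count n V E \<ge> 1}"
  have CON: "CON k m = Max A" unfolding CON_def hd A_def ..
  obtain g where g: "h = Suc g" using kh by (cases h) auto
  \<comment> \<open>Pascal's rule turns \<open>q < n' choose (k - 2)\<close> into the bound on the
    remainder that the stability lemma requires.\<close>
  have r: "(n' choose (k - 1)) + q < Suc n' choose h" using R(3) by (simp add: kh g)
  have upper: "real x \<le> real (n choose (k + 1)) + real (n' choose k) + s * (1 + root (k - 1) s)"
    if "x \<in> A" for x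
  proof -
    from that obtain V :: "nat set" and E where G: "x = clique_count (k + 1) V E" "simple_graph V E"
      "clique_count k V E = m" "clique_count n V E \<ge> 1" unfolding A_def by blast
    have fV: "finite V" using G by (simp add: simple_graph_def)
    have "{S \<in> nsets V n. clique S E} \<noteq> {}" using G(4) unfolding clique_count_def by (metis card.empty not_one_le_zero)
    then obtain K where K: "K \<subseteq> V" "card K = n" "clique K E" by (auto simp: nsets_def)
    have "real (clique_count (Suc (Suc h)) V E) \<le>
      real (card K choose Suc (Suc h)) + real (n' choose Suc h) + s * (1 + root h s)"
      using G(3) R(4) kh(2)
      by (intro clique_count_le_of_clique[OF fV K(1,3) _ _ r]) (simp_all add: K s kh(1))
    then show ?thesis by (simp add: G kh K)
  qed
  have "finite A"
  proof (rule finite_subset)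
    show "A \<subseteq> {..nat \<lfloor>real (n choose (k + 1)) + real (n' choose k) + s * (1 + root (k - 1) s)\<rfloor>}"
      by (intro subsetI) (simp only: atMost_iff le_nat_floor upper)
  qed auto
  obtain V :: "nat set" and E where G: "simple_graph V E" "clique_count n V E \<ge> 1"
    "clique_count (Suc h) V E = (n choose Suc h) + (n' choose h) + q"
    "clique_count (Suc (Suc h)) V E \<ge> (n choose Suc (Suc h)) + (n' choose Suc h)"
    using graph_with_clique_exists[of n' n h q] R(1,2) kh by (auto simp: g)
  have inA: "clique_count (k + 1) V E \<in> A"
    unfolding A_def mem_Collect_eq using G R(4)
    by (intro exI[of _ V] exI[of _ E]) (simp add: kh(1))
  then have "clique_count (k + 1) V E \<le> CON k m"
    unfolding CON using \<open>finite A\<close> by (rule Max_ge[rotated])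
  then have "(n choose Suc (Suc h)) + (n' choose Suc h) \<le> CON k m"
    using G(4) by (simp add: kh)
  then show "real (n choose (k + 1)) + real (n' choose k) \<le> real (CON k m)"
    by (simp add: kh flip: of_nat_add)
  show "real (CON k m) \<le> real (n choose (k + 1)) + real (n' choose k) + s * (1 + root (k - 1) s)"
    unfolding CON using inA \<open>finite A\<close> by (intro upper Max_in) auto
qed

section \<open>Estimates for \<open>LG\<close> and \<open>KK\<close>\<close>

text \<open>Since \<open>a choose Suc r \<le> a * (a choose r)\<close>, the tail of
  \<open>LG\<close> is at most \<open>hd as * q\<close>, and
  \<open>(a / h) ^ h \<le> a choose h \<le> q\<close> bounds \<open>a = hd as\<close> by
  \<open>h * root h q\<close>, where \<open>h = k - 1\<close>.\<close>

lemma LG_le: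
  assumes k: "k \<ge> 3" and m: "m \<ge> 1" and rep: "second_rep k m (n, n', as)"
    and q: "q = cval (k - 1) as"
  shows "real (LG k m) \<le> real (n choose (k + 1)) + real (n' choose k) +
    real (k - 1) * (real q * root (k - 1) (real q))"
proof -
  define h where "h = k - 1"
  have kh: "k = Suc h" "h \<ge> 2" using k by (auto simp: h_def)
  have casc: "casc h as" using rep unfolding second_rep_iff[OF k] h_def by auto
  have "(THE r. second_rep k m r) = (n, n', as)"
    by (rule the1_equality[OF second_rep_ex1[OF k m] rep])
  then have LG: "LG k m = (n choose (k + 1)) + (n' choose k) +
      (\<Sum>i=1..length as. (as ! (i - 1)) choose (k - i + 1))" by (simp add: LG_def)
  have len: "length as \<le> h" using casc by (simp add: casc_def)
  have "(\<Sum>i=1..length as. (as ! (i - 1)) choose (k - i + 1)) =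
      (\<Sum>i<length as. (as ! i) choose Suc (h - i))"
    using len by (simp add: sum.atLeast1_atMost_eq kh)
  also have "\<dots> \<le> hd as * q"
    unfolding q cval_sum sum_distrib_left
  proof (rule sum_mono)
    fix i assume i: "i \<in> {..<length as}"
    have "as ! i \<le> hd as"
    proof (cases "i = 0")
      case False
      then have "as ! i < as ! 0"
        using casc i by (auto simp: casc_def sorted_wrt_iff_nth_less)
      then show ?thesis using i by (subst hd_conv_nth) auto
    qed (use i in \<open>auto simp: hd_conv_nth\<close>)
    moreover have "(as ! i choose Suc (h - i)) \<le> as ! i * (as ! i choose (h - i))"
    proof -
      have "(as ! i choose Suc (h - i)) \<le> Suc (h - i) * (as ! i choose Suc (h - i))" by simp
      also have "\<dots> \<le> as ! i * (as ! i choose (h - i))"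
        using binomial_absorb_comp[of "as ! i" "h - i"] binomial_absorption[of "h - i" "as ! i"]
        by (metis diff_le_self mult_le_mono1)
      finally show ?thesis .
    qed
    ultimately have "(as ! i choose Suc (h - i)) \<le> hd as * (as ! i choose (h - i))"
      by (meson le_trans mult_le_mono1)
    then show "(as ! i choose Suc (h - i)) \<le> hd as * (as ! i choose (k - 1 - i))" by (simp add: kh)
  qed
  finally have "real (LG k m) \<le> real (n choose (k + 1)) + real (n' choose k) + real (hd as * q)"
    unfolding LG by (simp flip: of_nat_add of_nat_mult)
  moreover have "real (hd as * q) \<le> real h * (real q * root h (real q))"
  proof (cases as)
    \<comment> \<open>Here \<open>hd as\<close> is unspecified, but it is multiplied by
      \<open>q = 0\<close>.\<close>
    case Nil
    then show ?thesis by (simp add: q)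
  next
    case (Cons a as')
    have "a \<ge> h" using casc unfolding Cons casc_Cons by auto
    then have "(real a / real h) ^ h \<le> real (a choose h)"
      using binomial_ge_n_over_k_pow_k[of h a, where 'a = real] kh by simp
    also have "\<dots> \<le> real q" by (simp add: q Cons kh)
    finally have "root h ((real a / real h) ^ h) \<le> root h (real q)" using kh by simp
    then have "real a / real h \<le> root h (real q)" using kh by (simp add: real_root_power_cancel)
    then have "real a \<le> real h * root h (real q)" using kh by (simp add: field_simps)
    then have "real a * real q \<le> real h * root h (real q) * real q" by (rule mult_right_mono) simp
    then show ?thesis by (simp add: Cons ac_simps)
  qed
  ultimately show ?thesis by (simp add: h_def)
qed

text \<open>The canonical representation of \<open>m\<close> is \<open>n\<close>, \<open>n'\<close>
  followed by that of \<open>q\<close> at level \<open>k - 2\<close>; of this last part only the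
  leading term \<open>b\<close> is kept.\<close>

lemma KK_ge:
  assumes k: "k \<ge> 3" and rep: "second_rep k m (n, n', as)"
    and q: "q = cval (k - 1) as" "q \<ge> 1"
  obtains b where "q < Suc b choose (k - 2)"
    "KK k m \<ge> (n choose (k + 1)) + (n' choose k) + (b choose (k - 1))"
proof -
  have R: "n' < n" "k - 2 \<le> n'" "q < (n' choose (k - 2))"
    "m = (n choose k) + (n' choose (k - 1)) + q"
    using rep unfolding second_rep_iff[OF k] q by auto
  \<comment> \<open>The second representation admits \<open>n' = k - 2\<close>, the canonical one
    does not; in that case \<open>q < 1\<close>.\<close>
  have n': "k - 1 \<le> n'"
  proof (rule ccontr)
    assume "\<not> k - 1 \<le> n'"
    then have "n' = k - 2" using R(2) by linarith
    then show False using R(3) q(2) by simp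
  qed
  have "1 \<le> k - 2" using k by linarith
  then obtain bs where bs: "casc (k - 2) bs" "cval (k - 2) bs = q"
    using casc_exists[of "k - 2" q] by blast
  then obtain b bs' where b: "bs = b # bs'" using q(2) by (cases bs) auto
  have lt: "q < Suc b choose (k - 2)" using cval_less[of "k - 2" b bs'] bs b by simp
  have "b < n'"
    using R(3) bs b choose_mono[of n' b "k - 2"] by (rule_tac ccontr) simp
  moreover have "k \<le> n" "1 \<le> k" "1 \<le> k - 1" using n' R(1) k by linarith+
  moreover from calculation have "casc (k - 1) (n' # bs)"
    unfolding casc_Cons[of "k - 1"] using bs(1) n' by (simp add: b numeral_2_eq_2)
  ultimately have casc: "casc k (n # n' # bs)"
    unfolding casc_Cons[of k] using R(1) by simp
  have "k - 1 - 1 = k - 2" by simp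
  then have "canonical_rep k m (n # n' # bs)"
    using casc bs R by (simp add: canonical_rep_iff)
  moreover have "m \<ge> 1" using R q by simp
  ultimately have "canonical k m = n # n' # bs"
    unfolding canonical_def using k by (intro the1_equality canonical_rep_ex1) auto
  then have "KK k m = (n choose (k + 1)) + ((n' choose k) + ((b choose (k - 1)) +
      (\<Sum>i<length bs'. (bs' ! i) choose (k + 1 - Suc (Suc (Suc i))))))"
    by (simp add: KK_def b sum.lessThan_Suc_shift del: sum.lessThan_Suc)
  then have "KK k m \<ge> (n choose (k + 1)) + (n' choose k) + (b choose (k - 1))" by simp
  with lt show ?thesis by (rule that)
qed

section \<open>The ratio for typical \<open>m\<close>\<close>

lemma choose_le_power: "(n choose r) \<le> n ^ r"
proof -
  have "(n choose r) * 1 \<le> (n choose r) * fact r" by (intro mult_left_mono fact_ge_1) simp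
  then show ?thesis using binomial_fact_pow[of n r] by linarith
qed

text \<open>The errors in \<open>LG\<close> and \<open>CON\<close> have order at most
  \<open>S * root h S\<close> with \<open>S\<close> of order \<open>n ^ (k - 2)\<close>, which is
  negligible against \<open>n ^ (k - 1)\<close>, the order of \<open>KK\<close> minus the common
  base.\<close>

lemma rho_le_of_typical:
  assumes k: "k \<ge> 3" and e: "\<epsilon> > 0" and d: "0 < \<delta>" "\<delta> \<le> 1"
  shows "\<exists>n\<^sub>0. \<forall>m\<ge>1. \<forall>n n' as. second_rep k m (n, n', as) \<longrightarrow> n \<ge> n\<^sub>0 \<longrightarrow>
    real (cval (k - 1) as) \<ge> \<delta> * real n ^ (k - 2) \<longrightarrow> rho k m \<le> \<epsilon>"
proof -
  define g where "g = k - 2"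
  define h where "h = Suc g"
  have kg: "k = Suc (Suc g)" "g \<ge> 1" "k - 1 = h" "k - 2 = g" using k by (auto simp: g_def h_def)
  define c where "c = 2 * real k * real h"
  have c1: "c \<ge> 1" using mult_mono[of 1 "2 * real k" 1 "real h"] by (simp add: c_def h_def kg)
  \<comment> \<open>Chosen so that \<open>h * c * n ^ h * \<eta>\<close> equals
    \<open>\<epsilon> / (1 + \<epsilon>) * L\<close>; and
    \<open>err \<le> \<epsilon> / (1 + \<epsilon>) * L\<close> is the same as
    \<open>err \<le> \<epsilon> * (L - err)\<close>.\<close>
  define \<eta> where "\<eta> = \<epsilon> / (1 + \<epsilon>) * (\<delta> / (2 * real h)) ^ h / (real h * c)"
  have eta: "\<eta> > 0" using e d c1 by (simp add: \<eta>_def h_def)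
  have "(\<lambda>n. 1 / real n + root h (c / real n)) \<longlonglongrightarrow> 0 + root h 0"
    by (intro tendsto_add tendsto_real_root lim_const_over_n)
  then have "\<forall>\<^sub>F n in sequentially. 1 / real n + root h (c / real n) < \<eta>"
    using eta by (intro order_tendstoD(2)) auto
  then obtain n\<^sub>1 where n1: "\<And>n. n \<ge> n\<^sub>1 \<Longrightarrow> 1 / real n + root h (c / real n) < \<eta>"
    by (auto simp: eventually_sequentially)
  \<comment> \<open>The last term gives \<open>\<delta> * n \<ge> 2 * h\<close>, so that
    \<open>\<delta> * n \<le> b + 1\<close> below implies both
    \<open>b \<ge> \<delta> * n / 2\<close> and \<open>b \<ge> h\<close>.\<close>
  define n\<^sub>0 where "n\<^sub>0 = max (max 1 n\<^sub>1) (nat \<lceil>2 * real h / \<delta>\<rceil>)"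
  have "rho k m \<le> \<epsilon>"
    if m: "m \<ge> 1" and rep: "second_rep k m (n, n', as)" and n: "n \<ge> n\<^sub>0"
      and q: "real (cval h as) \<ge> \<delta> * real n ^ g" for m n n' as
  proof -
    have n_pos: "real n > 0" and nn1: "n \<ge> n\<^sub>1" using n by (auto simp: n\<^sub>0_def)
    have "2 * real h / \<delta> \<le> real n" using n by (simp add: n\<^sub>0_def)
    then have nd: "2 * real h \<le> \<delta> * real n" using d by (simp add: field_simps)
    define q where "q = cval h as"
    have n'n: "n' < n" and qn': "q < (n' choose g)"
      using rep unfolding second_rep_iff[OF k] kg(3,4) q_def by auto
    define base where "base = real (n choose (k + 1)) + real (n' choose k)"
    \<comment> \<open>\<open>S\<close> dominates both the stability error \<open>s\<close> and the
      remainder \<open>q\<close>; the factor \<open>h\<close> in \<open>err\<close> comes from the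
      bound on \<open>LG\<close>, so one \<open>err\<close> serves for \<open>LG\<close> and
      \<open>CON\<close>.\<close>
    define S where "S = c * real n ^ g"
    define err where "err = real h * (S * (1 + root h S))"
    define L where "L = (\<delta> * real n / (2 * real h)) ^ h"
    have L: "L > 0" using d n_pos by (simp add: L_def h_def)
    have S0: "S \<ge> 0" using c1 by (simp add: S_def)
    then have rS: "root h S \<ge> 0" by (rule real_root_ge_zero)
    have h1: "real h \<ge> 1" by (simp add: h_def)
    have err_le: "err \<le> \<epsilon> / (1 + \<epsilon>) * L"
    proof -
      have "S = real n ^ h * (c / real n)" using n_pos by (simp add: S_def h_def)
      then have rSn: "root h S = real n * root h (c / real n)"
        using real_root_power_cancel[of h "real n"] by (simp only: real_root_mult) (simp add: h_def)
      have "err = real h * c * real n ^ h * (1 / real n + root h (c / real n))"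
        using n_pos unfolding err_def rSn by (simp add: S_def h_def field_simps)
      also have "\<dots> \<le> real h * c * real n ^ h * \<eta>"
        using n1[OF nn1] c1 by (intro mult_left_mono) auto
      also have "\<dots> = \<epsilon> / (1 + \<epsilon>) * L"
        using c1 h1 by (simp add: \<eta>_def L_def power_divide power_mult_distrib)
      finally show ?thesis .
    qed
    define s where "s = 2 * real k * real (k - 1) * real (Suc n') ^ (k - 2)"
    have sS: "s \<le> S" "s \<ge> 0"
      using n'n unfolding s_def S_def c_def kg(3,4) by (auto intro!: mult_left_mono power_mono)
    have CON: "base \<le> real (CON k m)" "real (CON k m) \<le> base + s * (1 + root (k - 1) s)"
      using CON_bounds[OF k m rep s_def] by (auto simp: base_def)
    have "s * (1 + root h s) \<le> S * (1 + root h S)"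
      using sS by (intro mult_mono) (auto simp: h_def real_root_ge_zero)
    also have "\<dots> \<le> err"
      unfolding err_def using mult_right_mono[OF h1, of "S * (1 + root h S)"] S0 rS by simp
    finally have CON_le: "real (CON k m) \<le> base + err" using CON(2) unfolding kg(3) by linarith
    have "real q \<le> real (n' ^ g)"
      using qn' choose_le_power[of n' g] unfolding of_nat_le_iff by linarith
    also have "\<dots> \<le> 1 * real n ^ g" using n'n by (simp add: power_mono)
    also have "\<dots> \<le> S" unfolding S_def using c1 by (intro mult_right_mono) auto
    finally have qS: "real q \<le> S" .
    have "real q * root h (real q) \<le> S * root h S"
      using qS S0 by (intro mult_mono) (auto simp: h_def real_root_ge_zero)
    also have "\<dots> \<le> S * (1 + root h S)" using S0 by (simp add: algebra_simps)
    finally have "real h * (real q * root h (real q)) \<le> err"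
      unfolding err_def by (rule mult_left_mono) simp
    then have LG: "real (LG k m) \<le> base + err"
      using LG_le[OF k m rep refl] unfolding kg(3) q_def base_def by linarith
    have "\<delta> * real n ^ g > 0" using d n_pos by simp
    then have q1: "q \<ge> 1" using q unfolding q_def by linarith
    obtain b where b: "q < Suc b choose g"
      "KK k m \<ge> (n choose (k + 1)) + (n' choose k) + (b choose h)"
      using KK_ge[OF k rep refl] q1 unfolding kg(3,4) q_def by metis
    \<comment> \<open>As \<open>\<delta> \<le> 1\<close> and \<open>g \<ge> 1\<close>, the lower
      bound on \<open>q\<close> is at least a \<open>g\<close>-th power, and
      \<open>q < Suc b choose g\<close> then forces \<open>b\<close> to be linear in
      \<open>n\<close>.\<close>
    have "(\<delta> * real n) ^ g \<le> \<delta> * real n ^ g"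
      using d kg power_decreasing[of 1 g \<delta>] by (simp add: power_mult_distrib mult_right_mono)
    also have "\<dots> \<le> real q" using q by (simp add: q_def)
    also have "\<dots> \<le> real (Suc b ^ g)"
      using b(1) choose_le_power[of "Suc b" g] unfolding of_nat_le_iff by linarith
    finally have "(\<delta> * real n) ^ g \<le> real (Suc b) ^ g" by simp
    then have "\<delta> * real n \<le> real (Suc b)" 
      using kg(2) d n_pos power_mono_iff[of "\<delta> * real n" "real (Suc b)" g] by simp
    then have bn: "\<delta> * real n / 2 \<le> real b" using nd h1 by simp
    then have hb: "h \<le> b" using nd by linarith
    have "L \<le> (real b / real h) ^ h"
      unfolding L_def using bn d h1 by (intro power_mono) (auto simp: field_simps)
    also have "\<dots> \<le> real (b choose h)"
      using binomial_ge_n_over_k_pow_k[of h b, where 'a = real] hb by simp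
    finally have "L \<le> real (b choose h)" .
    moreover have "base + real (b choose h) \<le> real (KK k m)"
      using b(2) by (simp add: base_def flip: of_nat_add)
    ultimately have KK: "base + L \<le> real (KK k m)" by simp
    have "err * (1 + \<epsilon>) \<le> \<epsilon> * L" using err_le e by (simp add: field_simps)
    then have err2: "err \<le> \<epsilon> * (L - err)" by (simp add: algebra_simps)
    have err0: "err \<ge> 0" using S0 rS by (simp add: err_def)
    have "err < L"
    proof (rule ccontr)
      assume "\<not> err < L"
      then have "\<epsilon> * (L - err) \<le> 0" using e by (intro mult_nonneg_nonpos) auto
      then show False using err2 err0 \<open>\<not> err < L\<close> L by simp
    qed
    \<comment> \<open>Positivity also excludes the default value 1 of \<open>rho\<close>.\<close>
    then have pos: "real (KK k m) - real (CON k m) > 0" using KK CON_le by simp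
    have "real (LG k m) - real (CON k m) \<le> err" using LG CON by simp
    also have "\<dots> \<le> \<epsilon> * (L - err)" by (rule err2)
    also have "\<dots> \<le> \<epsilon> * (real (KK k m) - real (CON k m))"
      using e KK CON_le by (intro mult_left_mono) auto
    finally show ?thesis using pos by (simp add: rho_def divide_le_eq)
  qed
  then show ?thesis unfolding kg(3,4) by blast
qed

section \<open>Density of the exceptional \<open>m\<close>\<close>

theorem theorem4p6:
  fixes k :: nat and \<epsilon> :: real
  assumes "k \<ge> 3" and "\<epsilon> > 0"
  shows "(\<lambda>j. real (card {m \<in> {1..j}. rho k m > \<epsilon>}) / real j) \<longlonglongrightarrow> 0"
proof (rule LIMSEQ_I)
  fix e :: real assume e: "e > 0"
  \<comment> \<open>Chosen so that \<open>4 * X ^ k = c * j\<close> for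
    \<open>X = k * root k j\<close>, the bound on \<open>n\<close> used below.\<close>
  define c where "c = 4 * real k ^ k"
  have c: "c > 0" using assms by (simp add: c_def)
  define \<delta> where "\<delta> = min 1 (e / (2 * c))"
  have d: "0 < \<delta>" "\<delta> \<le> 1" using e c by (auto simp: \<delta>_def)
  have "\<delta> \<le> e / (2 * c)" by (simp add: \<delta>_def)
  then have dc: "c * \<delta> \<le> e / 2" using c by (simp add: field_simps)
  obtain n\<^sub>0 where n0: "\<And>m n n' as. m \<ge> 1 \<Longrightarrow> second_rep k m (n, n', as) \<Longrightarrow> n \<ge> n\<^sub>0 \<Longrightarrow>
    real (cval (k - 1) as) \<ge> \<delta> * real n ^ (k - 2) \<Longrightarrow> rho k m \<le> \<epsilon>"
    using rho_le_of_typical[OF assms d] by blast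
  define M where "M = (n\<^sub>0 choose k)"
  have bound: "real (card {m \<in> {1..j}. rho k m > \<epsilon>}) / real j \<le>
      real M / real j + c * \<delta> + c * root k (1 / real j)" if j: "j \<ge> 1" for j
  proof -
    define u where "u = root k (real j)"
    define X where "X = real k * u"
    have u1: "u \<ge> 1" using j assms by (simp add: u_def)
    have X1: "X \<ge> 1" using u1 assms mult_mono[of 1 "real k" 1 u] by (simp add: X_def)
    have uk: "u ^ k = real j" using assms by (simp add: u_def)
    have Xk: "4 * X ^ k = c * real j" by (simp add: X_def power_mult_distrib uk c_def)
    \<comment> \<open>Exceptional \<open>m \<le> j\<close> with \<open>n \<ge> n\<^sub>0\<close> are
      images under \<open>f\<close> of triples \<open>(n, n', q)\<close> in this box:
      \<open>(n / k) ^ k \<le> n choose k \<le> j\<close> bounds \<open>n\<close> when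
      \<open>n \<ge> k\<close>, and \<open>q\<close> is small because
      \<open>rho k m > \<epsilon>\<close>.\<close>
    define P where "P = {..nat \<lfloor>X\<rfloor>} \<times> {..nat \<lfloor>X\<rfloor>} \<times> {..nat \<lfloor>\<delta> * X ^ (k - 2)\<rfloor>}"
    define f where "f = (\<lambda>(n, n', q). (n choose k) + (n' choose (k - 1)) + (q::nat))"
    have "{m \<in> {1..j}. rho k m > \<epsilon>} \<subseteq> {..<M} \<union> f ` P"
    proof
      fix m assume m: "m \<in> {m \<in> {1..j}. rho k m > \<epsilon>}"
      then have m1: "m \<ge> 1" "m \<le> j" "rho k m > \<epsilon>" by auto
      obtain n n' as where rep: "second_rep k m (n, n', as)"
        using second_rep_ex1[OF assms(1) m1(1)] by (metis prod_cases3)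
      note br = second_rep_brackets[OF assms(1) rep]
      show "m \<in> {..<M} \<union> f ` P"
      proof (cases "n < n\<^sub>0")
        case True
        then have "m < M" using br(2) choose_mono[of "Suc n" "n\<^sub>0" k] by (simp add: M_def)
        then show ?thesis by simp
      next
        case False
        define q where "q = cval (k - 1) as"
        have qn: "real q < \<delta> * real n ^ (k - 2)"
          using n0[OF m1(1) rep] False m1(3) unfolding q_def by force
        have nX: "real n \<le> X"
        proof (cases "k \<le> n")
          case True
          have "(real n / real k) ^ k \<le> real (n choose k)"
            using True assms binomial_ge_n_over_k_pow_k[of k n, where 'a = real] by simp
          also have "\<dots> \<le> u ^ k" unfolding uk using br(1) m1(2) by simp
          finally have "real n / real k \<le> u"
            using assms u1 by (simp add: power_mono_iff)
          then show ?thesis using assms by (simp add: X_def field_simps)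
        next
          case False
          have "real k * 1 \<le> X" unfolding X_def using u1 by (intro mult_left_mono) auto
          then show ?thesis using False by simp
        qed
        have R: "n' < n" "m = (n choose k) + (n' choose (k - 1)) + q"
          using rep unfolding second_rep_iff[OF assms(1)] q_def by auto
        have "\<delta> * real n ^ (k - 2) \<le> \<delta> * X ^ (k - 2)"
          using nX d by (intro mult_left_mono power_mono) auto
        then have "real q \<le> \<delta> * X ^ (k - 2)" using qn by simp
        then have "(n, n', q) \<in> P"
          using nX R(1) by (auto simp: P_def intro!: le_nat_floor)
        moreover have "m = f (n, n', q)" using R by (simp add: f_def)
        ultimately show ?thesis by blast
      qed
    qed
    then have "card {m \<in> {1..j}. rho k m > \<epsilon>} \<le> card ({..<M} \<union> f ` P)"
      by (intro card_mono) (auto simp: P_def)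
    also have "\<dots> \<le> card {..<M} + card (f ` P)" by (rule card_Un_le)
    also have "\<dots> \<le> M + card P" using card_image_le[of P f] by (simp add: P_def)
    finally have "real (card {m \<in> {1..j}. rho k m > \<epsilon>}) \<le> real M + real (card P)"
      by (simp flip: of_nat_add)
    also have "real (card P) \<le> (2 * X) * ((2 * X) * (\<delta> * X ^ (k - 2) + 1))"
    proof -
      have "real (Suc (nat \<lfloor>X\<rfloor>)) \<le> 2 * X" using X1 by simp linarith
      moreover have "real (Suc (nat \<lfloor>\<delta> * X ^ (k - 2)\<rfloor>)) \<le> \<delta> * X ^ (k - 2) + 1"
        using X1 d by simp
      ultimately show ?thesis
        unfolding P_def card_cartesian_product card_atMost of_nat_mult
        using X1 by (intro mult_mono) auto
    qed
    also have "\<dots> = \<delta> * (4 * (X * X * X ^ (k - 2))) + 4 * (X * X)"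
      by (simp add: algebra_simps)
    also have "X * X * X ^ (k - 2) = X ^ k"
    proof -
      have "2 + (k - 2) = k" using assms(1) by linarith
      then show ?thesis by (metis power_add power2_eq_square)
    qed
    \<comment> \<open>This term comes from the \<open>+ 1\<close> in counting the values of
      \<open>q\<close>. It is of lower order than \<open>j\<close> because \<open>k \<ge> 3\<close>
      gives \<open>X * X * u \<le> X ^ k\<close>.\<close>
    also have "4 * (X * X) \<le> c * real j * (1 / u)"
    proof -
      have "X * X * X = X ^ 3" by (simp add: eval_nat_numeral)
      also have "\<dots> \<le> X ^ k" using X1 assms by (intro power_increasing) auto
      finally have "X * X * X \<le> X ^ k" .
      moreover have "X * X * u \<le> X * X * X"
        using u1 assms X1 by (intro mult_left_mono) (auto simp: X_def)
      ultimately have "4 * (X * X * u) \<le> c * real j" unfolding Xk[symmetric] by simp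
      then show ?thesis using u1 by (simp add: field_simps)
    qed
    finally have "real (card {m \<in> {1..j}. rho k m > \<epsilon>}) \<le>
        real M + (\<delta> * (c * real j) + c * real j * (1 / u))" unfolding Xk by simp
    moreover have "1 / u = root k (1 / real j)"
      using assms by (simp add: u_def real_root_divide)
    ultimately show ?thesis using j by (simp add: field_simps)
  qed
  have "(\<lambda>j. real M / real j + c * root k (1 / real j)) \<longlonglongrightarrow> 0 + c * root k 0"
    by (intro tendsto_add tendsto_mult tendsto_const tendsto_real_root lim_const_over_n)
  then have "\<forall>\<^sub>F j in sequentially. real M / real j + c * root k (1 / real j) < e / 2"
    using e by (intro order_tendstoD(2)) auto
  then obtain J where J: "\<And>j. j \<ge> J \<Longrightarrow> real M / real j + c * root k (1 / real j) < e / 2"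
    by (auto simp: eventually_sequentially)
  have "norm (real (card {m \<in> {1..j}. rho k m > \<epsilon>}) / real j - 0) < e" if "j \<ge> max 1 J" for j
  proof -
    have "real (card {m \<in> {1..j}. rho k m > \<epsilon>}) / real j < e"
      using bound[of j] J[of j] dc that by linarith
    then show ?thesis by simp
  qed
  then show "\<exists>no. \<forall>j\<ge>no. norm (real (card {m \<in> {1..j}. rho k m > \<epsilon>}) / real j - 0) < e"
    by blast
qed

end
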